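(* Let $n\ge 4$ be an even integer. Assume that $G$ is a complete edge-colored graph containing no rainbow $n$-cycles. Then $G$ contains no rainbow $(3n-8)$-cycles.
   Context: An edge-colored graph is a graph (possibly infinite) with an arbitrary assignment of a color to each edge. For $m\ge 3$, an $m$-cycle is a closed walk $v_0\to v_1\to\cdots\to v_{m-1}\to v_0$ through $m$ pairwise distinct vertices; it is rainbow if its $m$ edges have pairwise distinct colors. *)

theory Defs
  imports Main
begin

(* A simple graph, possibly infinite, is a vertex set V with a set E of two-element subsets of V.
   A coloring is a function c on vertex sets; only its values on E matter. *)

definition simple_graph :: "'a set \<Rightarrow> 'a set set \<Rightarrow> bool" where
  "simple_graph V E \<longleftrightarrow> (\<forall>e\<in>E. \<exists>u\<in>V. \<exists>v\<in>V. u \<noteq> v \<and> e = {u, v})"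

definition complete_graph :: "'a set \<Rightarrow> 'a set set \<Rightarrow> bool" where
  "complete_graph V E \<longleftrightarrow>
     simple_graph V E \<and> (\<forall>u\<in>V. \<forall>v\<in>V. u \<noteq> v \<longrightarrow> {u, v} \<in> E)"

(* The i-th edge of the closed walk vs ! 0, ..., vs ! (m - 1), vs ! 0 with m = length vs. *)
definition walk_edge :: "'a list \<Rightarrow> nat \<Rightarrow> 'a set" where
  "walk_edge vs i = {vs ! i, vs ! (Suc i mod length vs)}"

definition is_cycle :: "'a set \<Rightarrow> 'a set set \<Rightarrow> nat \<Rightarrow> 'a list \<Rightarrow> bool" where
  "is_cycle V E m vs \<longleftrightarrow>
     m \<ge> 3 \<and> length vs = m \<and> set vs \<subseteq> V \<and> distinct vs \<and> (\<forall>i<m. walk_edge vs i \<in> E)"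

definition rainbow :: "('a set \<Rightarrow> 'c) \<Rightarrow> 'a list \<Rightarrow> bool" where
  "rainbow c vs \<longleftrightarrow> inj_on (\<lambda>i. c (walk_edge vs i)) {..<length vs}"

definition has_rainbow_cycle :: "'a set \<Rightarrow> 'a set set \<Rightarrow> ('a set \<Rightarrow> 'c) \<Rightarrow> nat \<Rightarrow> bool" where
  "has_rainbow_cycle V E c m \<longleftrightarrow> (\<exists>vs. is_cycle V E m vs \<and> rainbow c vs)"

end

(* Write n = 2h + 2, so that 3n - 8 = 6h - 2, and index the vertices of a rainbow (6h - 2)-cycle by
   the integers modulo 6h - 2, the side e_i joining v_i and v_(i+1). Closing up n - 1 sides shows
   that the chord v_i v_(i+2h+1) has the color of one of the sides e_i, ..., e_(i+2h) it cuts off.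
   An n-cycle through the chords at i and i + 2h - 1 forces the former to take one of the last two
   of its candidate colors or the latter one of its first two. Since 3(2h - 1) = -1 modulo 6h - 2,
   iterating this shows that either all chords take one of their first two colors, or all take one
   of their last two; up to a reflection the former holds. Then the chord from v_a to v_(a-2h+3) is
   also colored like e_a or e_(a+1). A closed walk that moves forward along sides and along chords
   of these two kinds is therefore rainbow as soon as no chord used starts right before a visited
   vertex, and such a walk of length n exists. *)
theory Submission
  imports Defs
begin

section \<open>Arithmetic of the positions on the final cycle\<close>

text \<open>
  The positions of the final \<open>n\<close>-cycle for \<open>h = 2 * p + 2 - s\<close>, where \<open>s\<close> is the parity of \<open>h\<close>.
  All its steps are congruent to \<open>1\<close>, \<open>1 + 2 * h\<close> or \<open>1 + 4 * h\<close> modulo \<open>6 * h - 2\<close>. Alternating the last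
  two advances by \<open>4\<close>; the run of unit steps in the middle makes the second zigzag
  interleave with the first one without adjacent positions.
\<close>
definition tour :: "int \<Rightarrow> int \<Rightarrow> int \<Rightarrow> int" where
  "tour p s k = (if k < 2 * p then (if even k then 2 * k else 2 * k + 8 * p + 7 - 4 * s)
    else if k < 2 * p + 3 + 2 * s then k + 2 * p
    else if k < 4 * p + 4 then (if odd k then 2 * k - 2 * s - 3 else 2 * k - 4 * p - 6)
    else k + 8 * p + 4 - 4 * s)"

lemma tour_even: "tour p s (2 * a) = (if a < p then 4 * a
    else if 2 * a < 2 * p + 3 + 2 * s then 2 * a + 2 * p
    else if a < 2 * p + 2 then 4 * a - 4 * p - 6 else 2 * a + 8 * p + 4 - 4 * s)"
  by (auto simp: tour_def)

lemma tour_odd: "tour p s (2 * a + 1) = (if a < p then 4 * a + 8 * p + 9 - 4 * s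
    else if a < p + 1 + s then 2 * a + 1 + 2 * p
    else if a < 2 * p + 2 then 4 * a - 2 * s - 1 else 2 * a + 8 * p + 5 - 4 * s)"
  by (auto simp: tour_def)

text \<open>Each zigzag branch carries a parity or a residue modulo 4, because the ranges of the two
  even-valued branches can overlap and only the residues 0 and 2 separate them. Linear bounds
  separate the other branches from each other.\<close>

lemma tour_cases:
  assumes "s \<le> p" "0 \<le> s" "0 \<le> k"
  obtains a where "k = 2 * a" "0 \<le> a" "a < p" "tour p s k = 4 * a" "tour p s k mod 4 = 0"
  | a where "k = 2 * a + 1" "0 \<le> a" "a < p" "tour p s k = 4 * a + 8 * p + 9 - 4 * s" "odd (tour p s k)"
  | "2 * p \<le> k" "k < 2 * p + 3 + 2 * s" "tour p s k = k + 2 * p"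
  | a where "k = 2 * a + 1" "p + s < a" "a < 2 * p + 2" "tour p s k = 4 * a - 2 * s - 1" "odd (tour p s k)"
  | a where "k = 2 * a" "p + s + 2 \<le> a" "a < 2 * p + 2" "tour p s k = 4 * a - 4 * p - 6" "tour p s k mod 4 = 2"
  | "4 * p + 4 \<le> k" "tour p s k = k + 8 * p + 4 - 4 * s"
proof -
  obtain a where "k = 2 * a \<or> k = 2 * a + 1" by (metis oddE evenE)
  then show thesis
  proof
    assume k: "k = 2 * a"
    have "(4 * a - 4 * p - 6) mod 4 = 2" by presburger
    consider "a < p" | "p \<le> a" "2 * a < 2 * p + 3 + 2 * s" | "2 * p + 3 + 2 * s \<le> 2 * a" "a < 2 * p + 2"
      | "2 * p + 2 \<le> a" by linarith
    then show thesis
      by cases (use k assms that \<open>(4 * a - 4 * p - 6) mod 4 = 2\<close> in \<open>auto simp: tour_even\<close>)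
  next
    assume k: "k = 2 * a + 1"
    consider "a < p" | "p \<le> a" "a \<le> p + s" | "p + s < a" "a < 2 * p + 2" | "2 * p + 2 \<le> a"
      by linarith
    then show thesis
      by cases (use k assms that in \<open>auto simp: tour_odd\<close>)
  qed
qed

lemma tour_inj:
  assumes "s = 0 \<or> s = 1" "s \<le> p" "0 \<le> k" "k < l" "l < 4 * p + 6 - 2 * s"
  shows "tour p s k \<noteq> tour p s l"
proof
  assume eq: "tour p s k = tour p s l"
  have s: "0 \<le> s" "s \<le> 1" and "0 \<le> l" using assms by auto
  show False
    by (rule tour_cases[OF \<open>s \<le> p\<close> \<open>0 \<le> s\<close> \<open>0 \<le> k\<close>];
        rule tour_cases[OF \<open>s \<le> p\<close> \<open>0 \<le> s\<close> \<open>0 \<le> l\<close>];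
        (use assms(2-) eq s in linarith)?)
      (metis eq zero_neq_numeral)
qed

text \<open>The \<open>k\<close> allowed are those from which the tour jumps. A jump starts in a
  region where all visited positions have the same parity, so the next position is free.\<close>

lemma tour_succ:
  assumes "s = 0 \<or> s = 1" "s \<le> p" "0 \<le> k" "0 \<le> l" "l < 4 * p + 6 - 2 * s"
    "k < 2 * p \<or> 2 * p + 3 + 2 * s \<le> k \<and> k < 4 * p + 4"
  shows "tour p s l \<noteq> tour p s k + 1"
proof
  assume eq: "tour p s l = tour p s k + 1"
  have par: "x mod 4 = 0 \<or> x mod 4 = 2 \<Longrightarrow> even x" for x :: int by presburger
  have s: "0 \<le> s" "s \<le> 1" using assms by auto
  show False
    by (rule tour_cases[OF \<open>s \<le> p\<close> \<open>0 \<le> s\<close> \<open>0 \<le> k\<close>];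
        rule tour_cases[OF \<open>s \<le> p\<close> \<open>0 \<le> s\<close> \<open>0 \<le> l\<close>];
        (use assms(2-) eq s in linarith)?)
      (metis eq par even_plus_one_iff)+
qed

text \<open>For \<open>h = 2 * p + 2 - s\<close> the differences are \<open>2 * h + 1\<close>,
  \<open>3 - 4 * h\<close>, \<open>3 - 2 * h\<close> and \<open>4 * h + 1\<close>. The bound on
  \<open>tour p s k + 1\<close> keeps that position from wrapping around to the visited position
  0.\<close>

lemma tour_step:
  assumes "s = 0 \<or> s = 1" "s \<le> p" "0 \<le> k" "k < 4 * p + 6 - 2 * s"
  shows "tour p s (k + 1) = tour p s k + 1 \<or>
    (k < 2 * p \<or> 2 * p + 3 + 2 * s \<le> k \<and> k < 4 * p + 4) \<and> tour p s k + 1 < 12 * p + 10 - 6 * s \<and>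
    tour p s (k + 1) - tour p s k \<in>
      {4 * p + 5 - 2 * s, 4 * s - 8 * p - 5, 2 * s - 4 * p - 1, 8 * p + 9 - 4 * s}"
proof -
  obtain a where a: "k = 2 * a \<or> k = 2 * a + 1" by (metis oddE evenE)
  have n: "tour p s (2 + 2 * a) = (if a + 1 < p then 4 * a + 4
    else if 2 * a < 2 * p + 1 + 2 * s then 2 * a + 2 + 2 * p
    else if a < 2 * p + 1 then 4 * a - 4 * p - 2 else 2 * a + 8 * p + 6 - 4 * s)" for s
    using tour_even[of p s "a + 1"] by (simp add: add.commute)
  from a assms show ?thesis
    by (elim disjE; auto simp: tour_even tour_odd n; presburger)
qed

lemma tour_range:
  assumes "s = 0 \<or> s = 1" "s \<le> p" "0 \<le> k" "k < 4 * p + 6 - 2 * s"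
  shows "0 \<le> tour p s k \<and> tour p s k < 12 * p + 10 - 6 * s"
proof -
  obtain a where a: "k = 2 * a \<or> k = 2 * a + 1" by (metis oddE evenE)
  from a assms show ?thesis
    by (elim disjE) (simp_all add: tour_even tour_odd)
qed

section \<open>The long rainbow cycle as a periodic sequence\<close>

text \<open>Only the vertices of the long cycle are kept, indexed by all integers so that chord
  endpoints need no reduction. A candidate for a short cycle is a sequence \<open>w\<close> of
  indices, closed only modulo the period.\<close>

locale rainbow_closed_walk =
  fixes d :: "'a \<Rightarrow> 'a \<Rightarrow> 'c" and v :: "int \<Rightarrow> 'a" and h :: nat
  assumes h_ge_2: "h \<ge> 2"
    and d_sym: "d x y = d y x"
    and v_eq_iff: "v i = v j \<longleftrightarrow> i mod (6 * int h - 2) = j mod (6 * int h - 2)"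
    and e_eq_iff: "d (v i) (v (i + 1)) = d (v j) (v (j + 1)) \<longleftrightarrow>
      i mod (6 * int h - 2) = j mod (6 * int h - 2)"
    and no_rainbow: "\<And>w. inj_on (\<lambda>k. v (w k)) {..<2 * h + 2} \<Longrightarrow> v (w (2 * h + 2)) = v (w 0) \<Longrightarrow>
      \<not> inj_on (\<lambda>k. d (v (w k)) (v (w (Suc k)))) {..<2 * h + 2}"
begin

definition e :: "int \<Rightarrow> 'c" where "e i = d (v i) (v (i + 1))"
definition F :: "int \<Rightarrow> 'c" where "F i = d (v i) (v (i + 2 * int h + 1))"
text \<open>Modulo the period this chord leads from \<open>i\<close> forward to
  \<open>i + 4 * int h + 1\<close>.\<close>

definition G :: "int \<Rightarrow> 'c" where "G i = d (v i) (v (i - 2 * int h + 3))"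
definition low :: "int \<Rightarrow> bool" where "low i \<longleftrightarrow> F i = e i \<or> F i = e (i + 1)"
definition high :: "int \<Rightarrow> bool" where
  "high i \<longleftrightarrow> F i = e (i + 2 * int h - 1) \<or> F i = e (i + 2 * int h)"

lemma mod_eq_window:
  assumes "a \<le> i" "i < a + (6 * int h - 2)" "a \<le> j" "j < a + (6 * int h - 2)"
  shows "i mod (6 * int h - 2) = j mod (6 * int h - 2) \<longleftrightarrow> i = j"
proof
  assume "i mod (6 * int h - 2) = j mod (6 * int h - 2)"
  then have "(6 * int h - 2) dvd i - j" by (simp add: mod_eq_dvd_iff)
  moreover have "\<bar>i - j\<bar> < 6 * int h - 2" using assms by linarith
  ultimately have "i - j = 0" using dvd_imp_le_int[of "i - j" "6 * int h - 2"] by fastforce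
  then show "i = j" by simp
qed simp

lemma v_window:
  "a \<le> i \<Longrightarrow> i < a + (6 * int h - 2) \<Longrightarrow> a \<le> j \<Longrightarrow> j < a + (6 * int h - 2) \<Longrightarrow> v i = v j \<longleftrightarrow> i = j"
  using v_eq_iff mod_eq_window by blast

lemma e_window:
  "a \<le> i \<Longrightarrow> i < a + (6 * int h - 2) \<Longrightarrow> a \<le> j \<Longrightarrow> j < a + (6 * int h - 2) \<Longrightarrow> e i = e j \<longleftrightarrow> i = j"
  unfolding e_def using e_eq_iff mod_eq_window by blast

lemma v_add_period: "v (i + (6 * int h - 2)) = v i"
  using v_eq_iff by (metis mod_add_self2)

text \<open>Distinct indices within one period give distinct vertices, so \<open>w\<close> describes
  a cycle of length \<open>2 * h + 2\<close>, which cannot be rainbow.\<close>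

lemma obtain_repeated_color:
  assumes "\<And>k. k < 2 * h + 2 \<Longrightarrow> a \<le> w k \<and> w k < a + (6 * int h - 2)"
    and "\<And>k l. k < l \<Longrightarrow> l < 2 * h + 2 \<Longrightarrow> w k \<noteq> w l"
    and "v (w (2 * h + 2)) = v (w 0)"
  obtains k l where "k < l" "l < 2 * h + 2"
    "d (v (w k)) (v (w (Suc k))) = d (v (w l)) (v (w (Suc l)))"
proof -
  have "inj_on (\<lambda>k. v (w k)) {..<2 * h + 2}"
  proof (rule linorder_inj_onI)
    show "\<And>x y. x < y \<Longrightarrow> x \<in> {..<2 * h + 2} \<Longrightarrow> y \<in> {..<2 * h + 2} \<Longrightarrow> v (w x) \<noteq> v (w y)"
      using v_window assms(1,2) by (metis lessThan_iff)
  qed auto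
  then have "\<not> inj_on (\<lambda>k. d (v (w k)) (v (w (Suc k)))) {..<2 * h + 2}"
    using no_rainbow assms(3) by blast
  then show thesis
    unfolding inj_on_def using that by (metis lessThan_iff linorder_neqE_nat)
qed

section \<open>Colors of the chords \<open>F\<close>\<close>

text \<open>The cycle follows \<open>2 * h + 1\<close> sides from \<open>i\<close> and returns along
  the chord. The sides have distinct colors, so the repetition involves the chord.\<close>

lemma F_color: obtains x where "0 \<le> x" "x \<le> 2 * int h" "F i = e (i + x)"
proof -
  define w where "w k = (if k = 2 * h + 2 then i else i + int k)" for k :: nat
  obtain k l where kl: "k < l" "l < 2 * h + 2"
    "d (v (w k)) (v (w (Suc k))) = d (v (w l)) (v (w (Suc l)))"
    by (rule obtain_repeated_color[of i w]) (use h_ge_2 in \<open>auto simp: w_def\<close>)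
  have c: "d (v (w k)) (v (w (Suc k))) = e (i + int k)" if "k < 2 * h + 1" for k
    using that by (simp add: w_def e_def add_ac)
  have "d (v (w (2 * h + 1))) (v (w (Suc (2 * h + 1)))) = F i"
    by (simp add: w_def F_def d_sym[of "v i"] add_ac)
  moreover have "l = 2 * h + 1"
  proof (rule ccontr)
    assume "l \<noteq> 2 * h + 1"
    then have "e (i + int k) = e (i + int l)" using kl c[of k] c[of l] by simp
    then show False using e_window[of i "i + int k" "i + int l"] kl h_ge_2 by simp
  qed
  ultimately have "F i = e (i + int k)" using kl c[of k] by simp
  then show thesis using that[of "int k"] kl by simp
qed

lemma high_or_low: "high i \<or> low (i + 2 * int h - 1)"
proof -
  \<comment> \<open>The chord at \<open>i\<close>, two sides backwards, the chord at
    \<open>i + 2 * int h - 1\<close>, then \<open>2 * h - 2\<close> sides forward to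
    \<open>i + 6 * int h - 2\<close>.\<close>
  define w where "w k = (if k = 0 then i else if k < 4 then i + 2 * int h + 2 - int k
    else i + 4 * int h + int k - 4)" for k :: nat
  obtain k l where kl: "k < l" "l < 2 * h + 2"
    "d (v (w k)) (v (w (Suc k))) = d (v (w l)) (v (w (Suc l)))"
  proof (rule obtain_repeated_color[of i w])
    show "v (w (2 * h + 2)) = v (w 0)"
      using h_ge_2 v_add_period[of i] by (simp add: w_def algebra_simps)
    show "w k \<noteq> w l" if "k < l" "l < 2 * h + 2" for k l
      using that h_ge_2 by (auto simp: w_def)
  qed (use h_ge_2 in \<open>auto simp: w_def\<close>)
  obtain x where x: "0 \<le> x" "x \<le> 2 * int h" "F i = e (i + x)" by (rule F_color)
  obtain y where y: "0 \<le> y" "y \<le> 2 * int h" "F (i + 2 * int h - 1) = e (i + 2 * int h - 1 + y)"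
    by (rule F_color)
  define \<kappa> where "\<kappa> k = (if k = 0 then i + x else if k = 3 then i + 2 * int h - 1 + y
     else if k < 3 then i + 2 * int h + 1 - int k else i + 4 * int h + int k - 4)" for k :: nat
  have c: "d (v (w k)) (v (w (Suc k))) = e (\<kappa> k)" for k
  proof -
    consider "k = 0" | "k = 1" | "k = 2" | "k = 3" | "k > 3" by linarith
    then show ?thesis
    proof cases
      case 1 then show ?thesis using x by (simp add: w_def \<kappa>_def F_def add_ac)
    next
      case 2 then show ?thesis by (simp add: w_def \<kappa>_def e_def add_ac) (rule d_sym)
    next
      case 3
      show ?thesis using 3
        by (simp add: w_def \<kappa>_def e_def d_sym[of "v (i + 2 * int h)"])
    next
      case 4
      have *: "i + 2 * int h - 1 + 2 * int h + 1 = i + 4 * int h" by simp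
      show ?thesis using 4 y(3) unfolding F_def * by (simp add: w_def \<kappa>_def)
    next
      case 5
      have *: "i + 4 * int h + int (Suc k) - 4 = i + 4 * int h + int k - 4 + 1" by simp
      show ?thesis using 5 unfolding w_def \<kappa>_def e_def * by simp
    qed
  qed
  have "\<kappa> k = \<kappa> l"
    using e_window[of i "\<kappa> k" "\<kappa> l"] c kl x y h_ge_2 by (auto simp: \<kappa>_def split: if_splits)
  \<comment> \<open>The forward sides start at \<open>i + 4 * int h\<close>, beyond all candidates
    for either chord. So a chord repeats a backward side, or the chords agree: then
    \<open>x = 2 * int h - 1 + y\<close>, and \<open>x \<le> 2 * int h\<close> gives
    \<open>y \<le> 1\<close>.\<close>
  then have "x = 2 * int h - 1 \<or> x = 2 * int h \<or> y = 0 \<or> y = 1"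
    using kl(1,2) x(1,2) y(1,2) h_ge_2 by (auto simp: \<kappa>_def split: if_splits)
  then show ?thesis
    using x(3) y(3) unfolding low_def high_def by (auto simp: add_diff_eq)
qed

lemma low_not_high: "low i \<Longrightarrow> \<not> high i"
  unfolding low_def high_def
  using e_window[of i i "i + 2 * int h - 1"] e_window[of i i "i + 2 * int h"]
    e_window[of i "i + 1" "i + 2 * int h - 1"] e_window[of i "i + 1" "i + 2 * int h"] h_ge_2
  by auto

lemma low_cong:
  assumes "i mod (6 * int h - 2) = j mod (6 * int h - 2)"
  shows "low i \<longleftrightarrow> low j"
proof -
  have "v (i + x) = v (j + x)" for x
    unfolding v_eq_iff using assms by (metis mod_add_left_eq)
  from this[of 0] this[of 1] this[of 2] this[of "2 * int h + 1"] show ?thesis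
    unfolding low_def F_def e_def by (simp add: add.assoc)
qed

lemma all_high_or_all_low: "(\<forall>i. high i) \<or> (\<forall>i. low i)"
proof (rule disjCI)
  assume "\<not> (\<forall>i. low i)"
  then obtain i where i: "\<not> low i" by blast
  show "\<forall>j. high j"
  proof (rule ccontr)
    assume "\<not> (\<forall>j. high j)"
    then obtain j where j: "\<not> high j" by blast
    have *: "low (j + int (Suc k) * (2 * int h - 1))" for k
    proof (induction k)
      case 0 then show ?case using high_or_low[of j] j by (simp add: add_diff_eq)
    next
      case (Suc k)
      then show ?case
        using high_or_low[of "j + int (Suc k) * (2 * int h - 1)"] low_not_high
        by (fastforce simp: algebra_simps)
    qed
    \<comment> \<open>\<open>3 * (2 * h - 1) = M - 1\<close>, so \<open>3 * t\<close> of these steps lead from \<open>j\<close> to \<open>j - t\<close>.\<close>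
    define M where "M = 6 * int h - 2"
    define t where "t = (j - i) mod M + M"
    have M: "M > 0" using h_ge_2 by (simp add: M_def)
    \<comment> \<open>The summand \<open>M\<close> in \<open>t\<close> serves this: only positive
      numbers of steps are covered by \<open>*\<close>.\<close>
    then have "t > 0" unfolding t_def using pos_mod_sign[of M "j - i"] by linarith
    then obtain k where k: "int (Suc k) = 3 * t" by (metis mult_pos_pos zero_less_imp_eq_int Suc_pred' zero_less_numeral)
    have "(j + 3 * t * (2 * int h - 1)) mod M = i mod M"
    proof -
      have "j + 3 * t * (2 * int h - 1) = j - t + t * M" by (simp add: M_def algebra_simps)
      also have "\<dots> mod M = (j - (j - i)) mod M"
        unfolding t_def by (metis mod_add_self2 mod_diff_right_eq mod_mult_self1)
      finally show ?thesis by simp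
    qed
    then show False using low_cong i * k unfolding M_def by metis
  qed
qed

section \<open>Chords \<open>G\<close> and the contradiction when all chords are low\<close>

context
  assumes all_low: "\<And>i. low i"
begin

text \<open>The cycle takes \<open>t\<close> sides from \<open>a\<close>, the chord at
  \<open>a + int t\<close>, sides up to \<open>a + 4 * int h + 1\<close> and the chord
  \<open>G a\<close> back. The first chord has the color of a side that it skips, so the repetition
  must involve \<open>G a\<close>.\<close>

lemma G_color_aux:
  assumes "t \<le> 2 * h"
  shows "G a = F (a + int t) \<or> (\<exists>x. G a = e (a + x) \<and>
    (0 \<le> x \<and> x < int t \<or> int t + 2 * int h + 1 \<le> x \<and> x \<le> 4 * int h))"
proof -
  define w where "w k = (if k = 2 * h + 2 then a else if k \<le> t then a + int k
    else a + 2 * int h + int k)" for k :: nat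
  obtain k l where kl: "k < l" "l < 2 * h + 2"
    "d (v (w k)) (v (w (Suc k))) = d (v (w l)) (v (w (Suc l)))"
  proof (rule obtain_repeated_color[of a w])
    show "w k \<noteq> w l" if "k < l" "l < 2 * h + 2" for k l
      using that h_ge_2 by (auto simp: w_def)
  qed (use h_ge_2 assms in \<open>auto simp: w_def\<close>)
  obtain y where y: "y = 0 \<or> y = 1" "F (a + int t) = e (a + int t + y)"
    using all_low[of "a + int t"] unfolding low_def by (metis add.right_neutral)
  define x where "x k = (if k = t then int t + y else if k < t then int k
    else 2 * int h + int k)" for k :: nat
  have c: "d (v (w k)) (v (w (Suc k))) = e (a + x k)" if "k < 2 * h + 1" for k
  proof (cases "k = t")
    case True
    then have "d (v (w k)) (v (w (Suc k))) = F (a + int t)"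
      using that by (simp add: w_def F_def add_ac)
    then show ?thesis using y True by (simp add: x_def add_ac)
  next
    case False
    then show ?thesis using that by (auto simp: w_def x_def e_def add_ac)
  qed
  have "v (a - 2 * int h + 3) = v (a + 4 * int h + 1)"
    using v_add_period[of "a - 2 * int h + 3"] by (simp add: algebra_simps)
  then have cG: "d (v (w (2 * h + 1))) (v (w (Suc (2 * h + 1)))) = G a"
    using assms by (simp add: w_def G_def d_sym[of "v a"] add_ac)
  have "l = 2 * h + 1"
  proof (rule ccontr)
    assume l: "l \<noteq> 2 * h + 1"
    then have "e (a + x k) = e (a + x l)" using kl c[of k] c[of l] by simp
    moreover have "0 \<le> x k \<and> x k < 6 * int h - 2" "0 \<le> x l \<and> x l < 6 * int h - 2"
      using kl l y assms h_ge_2 by (auto simp: x_def)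
    ultimately have "x k = x l" using e_window[of a "a + x k" "a + x l"] by simp
    then show False using kl y assms h_ge_2 l by (auto simp: x_def split: if_splits)
  qed
  then have "G a = e (a + x k)" "k < 2 * h + 1" using kl c[of k] cG by auto
  then show ?thesis using y
    by (cases "k = t") (auto simp: x_def add_ac split: if_splits intro!: exI[of _ "x k"])
qed

lemma G_color: "G a = e a \<or> G a = e (a + 1)"
proof -
  have *: "\<exists>x. G a = e (a + x) \<and>
    (0 \<le> x \<and> x < int t + 2 \<or> int t + 2 * int h + 1 \<le> x \<and> x \<le> 4 * int h)" if "t \<le> 2 * h" for t
  proof -
    have "F (a + int t) = e (a + int t) \<or> F (a + int t) = e (a + (int t + 1))"
      using all_low[of "a + int t"] by (simp add: low_def add.assoc)
    moreover have "0 \<le> int t \<and> int t < int t + 2" "0 \<le> int t + 1 \<and> int t + 1 < int t + 2"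
      by simp_all
    moreover have "y < int t + 2" if "y < int t" for y using that by simp
    ultimately show ?thesis using G_color_aux[of t a] that by metis
  qed
  obtain x where x: "G a = e (a + x)" "0 \<le> x \<and> x \<le> 2 * int h + 1"
    using *[of "2 * h"] by auto
  obtain y where y: "G a = e (a + y)" "0 \<le> y \<and> y \<le> 1 \<or> 2 * int h + 1 \<le> y \<and> y \<le> 4 * int h"
    using *[of 0] by auto
  obtain z where z: "G a = e (a + z)" "0 \<le> z \<and> z \<le> 2 \<or> 2 * int h + 2 \<le> z \<and> z \<le> 4 * int h"
    using *[of 1] h_ge_2 by auto
  \<comment> \<open>The candidates left by \<open>t = 2 * h\<close> and \<open>t = 0\<close> are \<open>0\<close>, \<open>1\<close>, \<open>2 * h + 1\<close>; the last is excluded by \<open>t = 1\<close>.\<close>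
  have u: "y = x" if "G a = e (a + y)" "0 \<le> y" "y \<le> 4 * int h" for y
    using e_window[of a "a + x" "a + y"] that x h_ge_2 by simp
  have "x = 0 \<or> x = 1" using u[OF y(1)] u[OF z(1)] y z x h_ge_2 by linarith
  then show ?thesis using x by auto
qed

text \<open>Modulo the period, the four differences are those of the two kinds of chords.\<close>
lemma no_directed_closed_walk:
  assumes range: "\<And>k. k < 2 * h + 2 \<Longrightarrow> 0 \<le> w k \<and> w k < 6 * int h - 2"
    and inj: "\<And>k l. k < l \<Longrightarrow> l < 2 * h + 2 \<Longrightarrow> w k \<noteq> w l"
    and closed: "w 0 = 0" "w (2 * h + 2) = 6 * int h - 2"
    and step: "\<And>k. k < 2 * h + 2 \<Longrightarrow> w (Suc k) = w k + 1 \<or>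
      w (Suc k) - w k \<in> {2 * int h + 1, 3 - 4 * int h, 3 - 2 * int h, 4 * int h + 1} \<and>
      w k + 1 < 6 * int h - 2 \<and> (\<forall>l < 2 * h + 2. w l \<noteq> w k + 1)"
  shows False
proof -
  have "v (w (2 * h + 2)) = v (w 0)" using closed v_add_period[of 0] by simp
  then obtain k l where kl: "k < l" "l < 2 * h + 2"
    "d (v (w k)) (v (w (Suc k))) = d (v (w l)) (v (w (Suc l)))"
    using obtain_repeated_color[of 0 w] range inj by auto
  \<comment> \<open>Each step is colored like the side at its own start or at the next position,
    which is then unvisited. Hence steps of equal color start at the same position.\<close>
  have c: "\<exists>x. d (v (w k)) (v (w (Suc k))) = e x \<and>
    (x = w k \<or> x = w k + 1 \<and> x < 6 * int h - 2 \<and> (\<forall>l < 2 * h + 2. w l \<noteq> x))"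
    if "k < 2 * h + 2" for k
  proof (cases "w (Suc k) = w k + 1")
    case True
    then show ?thesis by (auto simp: e_def)
  next
    case False
    then have s: "w (Suc k) - w k \<in> {2 * int h + 1, 3 - 4 * int h, 3 - 2 * int h, 4 * int h + 1}"
      and n: "w k + 1 < 6 * int h - 2" "\<forall>l < 2 * h + 2. w l \<noteq> w k + 1"
      using step[OF that] by auto
    have "v (w (Suc k)) = v (w k + 2 * int h + 1) \<or> v (w (Suc k)) = v (w k - 2 * int h + 3)"
    proof -
      consider "w (Suc k) = w k + 2 * int h + 1" | "w k + 2 * int h + 1 = w (Suc k) + (6 * int h - 2)"
        | "w (Suc k) = w k - 2 * int h + 3" | "w (Suc k) = w k - 2 * int h + 3 + (6 * int h - 2)"
        using s by fastforce
      then show ?thesis by cases (simp_all only: v_add_period simp_thms)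
    qed
    then have "d (v (w k)) (v (w (Suc k))) \<in> {e (w k), e (w k + 1)}"
      using all_low[of "w k"] G_color[of "w k"] unfolding low_def F_def G_def by auto
    then show ?thesis using n by auto
  qed
  obtain x where x: "d (v (w k)) (v (w (Suc k))) = e x"
    "x = w k \<or> x = w k + 1 \<and> x < 6 * int h - 2 \<and> (\<forall>l < 2 * h + 2. w l \<noteq> x)"
    using c[of k] kl by auto
  obtain y where y: "d (v (w l)) (v (w (Suc l))) = e y"
    "y = w l \<or> y = w l + 1 \<and> y < 6 * int h - 2 \<and> (\<forall>k < 2 * h + 2. w k \<noteq> y)"
    using c[of l] kl by auto
  have "x = y" using e_window[of 0 x y] x y kl range[of k] range[of l] by auto
  then show False using x(2) y(2) kl inj[of k l] by auto
qed

lemma not_all_low: False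
proof -
  define s where "s = h mod 2"
  \<comment> \<open>This solves \<open>h = 2 * p + 2 - s\<close>. An odd \<open>h\<close> is at
    least 3, which gives \<open>s \<le> p\<close>.\<close>
  define p where "p = (h + s) div 2 - 1"
  have s: "s = 0 \<or> s = 1" by (auto simp: s_def)
  have h: "h + s = 2 * p + 2" and ps: "s \<le> p"
    using h_ge_2 unfolding s_def p_def by presburger+
  have tour_args: "int s = 0 \<or> int s = 1" "int s \<le> int p" using s ps by auto
  have n: "4 * int p + 6 - 2 * int s = 2 * int h + 2" and M: "12 * int p + 10 - 6 * int s = 6 * int h - 2"
    and jumps: "4 * int p + 5 - 2 * int s = 2 * int h + 1" "4 * int s - 8 * int p - 5 = 3 - 4 * int h"
      "2 * int s - 4 * int p - 1 = 3 - 2 * int h" "8 * int p + 9 - 4 * int s = 4 * int h + 1"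
    using h by linarith+
  show False
  proof (rule no_directed_closed_walk[of "\<lambda>k. tour (int p) (int s) (int k)"])
    show "tour (int p) (int s) (int 0) = 0" by (auto simp: tour_def)
    show "tour (int p) (int s) (int (2 * h + 2)) = 6 * int h - 2"
      unfolding tour_def using tour_args n M by auto
    show "0 \<le> tour (int p) (int s) (int k) \<and> tour (int p) (int s) (int k) < 6 * int h - 2" if "k < 2 * h + 2" for k
      using tour_range[OF tour_args, of "int k"] that unfolding n M by simp
    show "tour (int p) (int s) (int k) \<noteq> tour (int p) (int s) (int l)" if "k < l" "l < 2 * h + 2" for k l
      using tour_inj[OF tour_args, of "int k" "int l"] that unfolding n by simp
    show "tour (int p) (int s) (int (Suc k)) = tour (int p) (int s) (int k) + 1 \<or>
      tour (int p) (int s) (int (Suc k)) - tour (int p) (int s) (int k)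
        \<in> {2 * int h + 1, 3 - 4 * int h, 3 - 2 * int h, 4 * int h + 1} \<and>
      tour (int p) (int s) (int k) + 1 < 6 * int h - 2 \<and>
      (\<forall>l < 2 * h + 2. tour (int p) (int s) (int l) \<noteq> tour (int p) (int s) (int k) + 1)" if "k < 2 * h + 2" for k
    proof -
      have k: "int k < 2 * int h + 2" using that by simp
      have Suc: "int (Suc k) = int k + 1" by simp
      consider "tour (int p) (int s) (int (Suc k)) = tour (int p) (int s) (int k) + 1"
        | "int k < 2 * int p \<or> 2 * int p + 3 + 2 * int s \<le> int k \<and> int k < 4 * int p + 4"
          "tour (int p) (int s) (int k) + 1 < 6 * int h - 2"
          "tour (int p) (int s) (int (Suc k)) - tour (int p) (int s) (int k)
            \<in> {2 * int h + 1, 3 - 4 * int h, 3 - 2 * int h, 4 * int h + 1}"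
        using tour_step[OF tour_args of_nat_0_le_iff, of k] k unfolding n M jumps Suc by blast
      then show ?thesis
      proof cases
        case 2
        have "tour (int p) (int s) (int l) \<noteq> tour (int p) (int s) (int k) + 1" if "l < 2 * h + 2" for l
          using tour_succ[OF tour_args _ _ _ 2(1), of "int l"] that unfolding n by simp
        then show ?thesis using 2 by blast
      qed blast
    qed
  qed
qed

end

section \<open>Reversing the orientation\<close>

lemma reflection: "rainbow_closed_walk d (\<lambda>i. v (- i)) h"
proof
  have neg_mod: "(- i) mod m = (- j) mod m \<longleftrightarrow> i mod m = j mod m" for i j m :: int
    by (metis minus_minus mod_minus_cong)
  show "v (- i) = v (- j) \<longleftrightarrow> i mod (6 * int h - 2) = j mod (6 * int h - 2)" for i j
    using v_eq_iff neg_mod by simp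
  show "d (v (- i)) (v (- (i + 1))) = d (v (- j)) (v (- (j + 1))) \<longleftrightarrow>
    i mod (6 * int h - 2) = j mod (6 * int h - 2)" for i j
  proof -
    \<comment> \<open>The reversed side at \<open>i\<close> is the original side at
      \<open>- (i + 1)\<close>, whence the shift by one.\<close>
    have "d (v (- i)) (v (- (i + 1))) = d (v (- (i + 1))) (v (- (i + 1) + 1))" for i
      by (simp add: d_sym[of "v (- i)"])
    then have "d (v (- i)) (v (- (i + 1))) = d (v (- j)) (v (- (j + 1))) \<longleftrightarrow>
      (i + 1) mod (6 * int h - 2) = (j + 1) mod (6 * int h - 2)"
      unfolding neg_mod[of "i + 1" _ "j + 1", symmetric]
      using e_eq_iff[of "- (i + 1)" "- (j + 1)"] by simp
    then show ?thesis by (simp add: mod_eq_dvd_iff)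
  qed
  show "\<not> inj_on (\<lambda>k. d (v (- w k)) (v (- w (Suc k)))) {..<2 * h + 2}"
    if "inj_on (\<lambda>k. v (- w k)) {..<2 * h + 2}" "v (- w (2 * h + 2)) = v (- w 0)" for w
    using no_rainbow[of "\<lambda>k. - w k"] that .
qed (use h_ge_2 d_sym in auto)

lemma inconsistent: False
proof (cases "\<forall>i. low i")
  case True
  then show False using not_all_low by blast
next
  case False
  then have high: "high i" for i using all_high_or_all_low by blast
  interpret r: rainbow_closed_walk d "\<lambda>i. v (- i)" h by (rule reflection)
  \<comment> \<open>Reversal turns the last two sides cut off by a chord into the first two, so
    \<open>high\<close> becomes \<open>r.low\<close>.\<close>
  have "r.e i = e (- i - 1)" for i
    by (simp add: r.e_def e_def d_sym[of "v (- i)"])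
  moreover have "r.F i = F (- i - 2 * int h - 1)" for i
    by (simp add: r.F_def F_def d_sym[of "v (- i)"])
  moreover have "F (- i - 2 * int h - 1) = e (- (i + 1) - 1) \<or> F (- i - 2 * int h - 1) = e (- i - 1)" for i
  proof -
    have "- i - 2 * int h - 1 + 2 * int h - 1 = - (i + 1) - 1" "- i - 2 * int h - 1 + 2 * int h = - i - 1"
      by simp_all
    then show ?thesis using high[of "- i - 2 * int h - 1"] unfolding high_def by metis
  qed
  ultimately have "r.low i" for i
    unfolding r.low_def by auto
  then show False by (rule r.not_all_low)
qed

end

section \<open>Transfer to complete graphs\<close>

text \<open>The condition \<open>f m = f 0\<close> replaces the modular index in
  \<open>walk_edge\<close>; completeness supplies the edges once consecutive vertices
  differ.\<close>

lemma has_rainbow_cycleI: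
  assumes "complete_graph V E" "m \<ge> 3" "\<And>k. f k \<in> V" "inj_on f {..<m}" "f m = f 0"
    and "inj_on (\<lambda>k. c {f k, f (Suc k)}) {..<m}"
  shows "has_rainbow_cycle V E c m"
proof -
  define vs where "vs = map f [0..<m]"
  have edge: "walk_edge vs i = {f i, f (Suc i)}" if "i < m" for i
  proof (cases "Suc i = m")
    case True
    then show ?thesis using assms that by (simp add: vs_def walk_edge_def)
  qed (use that in \<open>simp add: vs_def walk_edge_def\<close>)
  have "f i \<noteq> f (Suc i)" if "i < m" for i
  proof (cases "Suc i = m")
    case True
    then show ?thesis using assms(2,5) inj_onD[OF assms(4), of i 0] by auto
  next
    case False
    then show ?thesis using that inj_onD[OF assms(4), of i "Suc i"] by auto
  qed
  then have "walk_edge vs i \<in> E" if "i < m" for i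
    using assms(1,3) that edge unfolding complete_graph_def by auto
  moreover have "distinct vs" "set vs \<subseteq> V" "length vs = m"
    using assms(3,4) by (auto simp: vs_def distinct_map atLeast0LessThan)
  moreover have "inj_on (\<lambda>i. c (walk_edge vs i)) {..<m}"
    using assms(6) edge by (auto simp: inj_on_def)
  ultimately show ?thesis
    unfolding has_rainbow_cycle_def is_cycle_def rainbow_def using assms(2) by blast
qed

theorem theorem3p4:
  fixes V :: "'a set" and E :: "'a set set" and c :: "'a set \<Rightarrow> 'c" and n :: nat
  assumes "n \<ge> 4" and "even n"
    and "complete_graph V E"
    and "\<not> has_rainbow_cycle V E c n"
  shows "\<not> has_rainbow_cycle V E c (3 * n - 8)"
proof
  assume rc: "has_rainbow_cycle V E c (3 * n - 8)"
  define h where "h = n div 2 - 1"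
  have n: "n = 2 * h + 2" and h1: "h \<ge> 1" using assms(1,2) by (auto simp: h_def elim!: evenE)
  \<comment> \<open>For \<open>n = 4\<close> the lengths \<open>n\<close> and
    \<open>3 * n - 8\<close> coincide.\<close>
  have "h \<noteq> 1" using rc assms(4) n by auto
  then have h: "h \<ge> 2" using h1 by simp
  define m where "m = 6 * h - 2"
  have m: "m = 3 * n - 8" "int m = 6 * int h - 2" "m > 2" using n h by (auto simp: m_def)
  obtain vs where vs: "length vs = m" "set vs \<subseteq> V" "distinct vs"
    and rb: "inj_on (\<lambda>i. c (walk_edge vs i)) {..<m}"
    using rc unfolding has_rainbow_cycle_def is_cycle_def rainbow_def m(1) by auto
  define v where "v i = vs ! nat (i mod int m)" for i
  have pos: "nat (i mod int m) < m" for i using m(3) by (simp add: nat_less_iff)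
  have nat_mod: "nat (i mod int m) = nat (j mod int m) \<longleftrightarrow> i mod int m = j mod int m" for i j
    using m(3) by (simp add: nat_eq_iff)
  have v_V: "v i \<in> V" for i using vs pos[of i] unfolding v_def by (metis nth_mem subsetD)
  have edge: "{v i, v (i + 1)} = walk_edge vs (nat (i mod int m))" for i
  proof -
    have "(i + 1) mod int m = int (Suc (nat (i mod int m)) mod m)"
      using m(3) by (simp add: zmod_int mod_simps add.commute)
    then show ?thesis unfolding walk_edge_def v_def vs(1) by simp
  qed
  have "rainbow_closed_walk (\<lambda>x y. c {x, y}) v h"
  proof
    show "v i = v j \<longleftrightarrow> i mod (6 * int h - 2) = j mod (6 * int h - 2)" for i j
      unfolding v_def m(2)[symmetric] using nth_eq_iff_index_eq[OF vs(3)] vs(1) pos nat_mod by simp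
    show "c {v i, v (i + 1)} = c {v j, v (j + 1)} \<longleftrightarrow>
        i mod (6 * int h - 2) = j mod (6 * int h - 2)" for i j
      unfolding edge m(2)[symmetric] using inj_on_eq_iff[OF rb] pos nat_mod by simp
    show "\<not> inj_on (\<lambda>k. c {v (w k), v (w (Suc k))}) {..<2 * h + 2}"
      if "inj_on (\<lambda>k. v (w k)) {..<2 * h + 2}" "v (w (2 * h + 2)) = v (w 0)" for w
      using has_rainbow_cycleI[OF assms(3), of n "\<lambda>k. v (w k)" c] that v_V assms(4) h
      unfolding n by auto
  qed (use h in \<open>auto simp: insert_commute\<close>)
  then show False by (rule rainbow_closed_walk.inconsistent)
qed

end
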